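(* There is a family of lower-bounded facility location (LBFL) instances with $n$ facilities and $n^4-n$ clients such that the relaxations obtained from (LP-classic) at $\Omega(n)$ levels of the Sherali-Adams hierarchy have an unbounded integrality gap.
   Context: LBFL: facilities $F$ with opening costs $f_i$, unit-demand clients $C$, metric connection costs $c_{ij}$, uniform lower bound $B$ (each open facility must be assigned at least $B$ clients); minimize opening plus connection cost. (LP-classic) for LBFL: minimize $\sum_i f_iy_i+\sum_{i,j}c_{ij}x_{ij}$ subject to $x_{ij}\le y_i$, $\sum_i x_{ij}=1$ for all $j$, $\sum_j x_{ij}\ge By_i$ for all $i$, $0\le y_i,x_{ij}\le1$. Sherali-Adams level $k$: multiply each constraint by all products $\prod_{x_i\in U'-W}x_i\prod_{x_i\in W}(1-x_i)$ with $|U'|\le k$, $W\subseteq U'$, linearize ($x_i^2\to x_i$, $\prod_{x_i\in I}x_i\to x_I$), and project onto the original variables. *)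

theory Defs
  imports
    "HOL-Library.Poly_Mapping"
    "HOL-Library.Extended_Real"
    "HOL-Library.Landau_Symbols"
begin

section \<open>The Sherali-Adams hierarchy\<close>

text \<open>Multivariate polynomials with real coefficients: a finitely supported map from monomials
  (finitely supported exponent maps) to coefficients with the convolution product.\<close>

type_synonym 'v polynomial = "('v \<Rightarrow>\<^sub>0 nat) \<Rightarrow>\<^sub>0 real"

definition pvar :: "'v \<Rightarrow> 'v polynomial" where
  "pvar v = Poly_Mapping.single (Poly_Mapping.single v 1) 1"

text \<open>A monomial \<open>m\<close> is replaced by the lifted variable indexed by its support, which
  covers both \<open>x\<^sup>2 \<rightarrow> x\<close> and the replacement of \<open>\<Prod>i\<in>I. x i\<close> by \<open>X I\<close>.\<close>

definition linearize :: "('v set \<Rightarrow> real) \<Rightarrow> 'v polynomial \<Rightarrow> real" where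
  "linearize X p = (\<Sum>m\<in>Poly_Mapping.keys p. Poly_Mapping.lookup p m * X (Poly_Mapping.keys m))"

definition sa_multiplier :: "'v set \<Rightarrow> 'v set \<Rightarrow> 'v polynomial" where
  "sa_multiplier U W = (\<Prod>v\<in>U - W. pvar v) * (\<Prod>v\<in>W. 1 - pvar v)"

text \<open>The constraint system over the variables \<open>V\<close> is given by the polynomials \<open>G\<close>
  (read as \<open>g \<ge> 0\<close>) and \<open>H\<close> (read as \<open>h = 0\<close>). Only the values \<open>X I\<close> with \<open>card I \<le> k + 1\<close>
  occur in the constraints below when \<open>G\<close> and \<open>H\<close> are affine.\<close>

definition sa_lifted :: "nat \<Rightarrow> 'v set \<Rightarrow> 'v polynomial set \<Rightarrow> 'v polynomial set \<Rightarrow> ('v set \<Rightarrow> real) set"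
  where
  "sa_lifted k V G H = {X. X {} = 1 \<and>
     (\<forall>U W. finite U \<and> U \<subseteq> V \<and> card U \<le> k \<and> W \<subseteq> U \<longrightarrow>
        (\<forall>g\<in>G. linearize X (g * sa_multiplier U W) \<ge> 0) \<and>
        (\<forall>h\<in>H. linearize X (h * sa_multiplier U W) = 0))}"

definition sherali_adams :: "nat \<Rightarrow> 'v set \<Rightarrow> 'v polynomial set \<Rightarrow> 'v polynomial set \<Rightarrow> ('v \<Rightarrow> real) set"
  where
  "sherali_adams k V G H = {z. \<exists>X\<in>sa_lifted k V G H. \<forall>v\<in>V. z v = X {v}}"


section \<open>Lower-bounded facility location\<close>

record ('f, 'c) lbfl =
  facilities :: "'f set"
  clients :: "'c set"
  opening_cost :: "'f \<Rightarrow> real"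
  connection_cost :: "'f \<Rightarrow> 'c \<Rightarrow> real"
  lower_bound :: nat

text \<open>Distinct facilities and clients may share a location, hence distance 0 between distinct
  points of \<open>F <+> C\<close> is allowed.\<close>

definition metric_costs :: "'f set \<Rightarrow> 'c set \<Rightarrow> ('f \<Rightarrow> 'c \<Rightarrow> real) \<Rightarrow> bool" where
  "metric_costs F C c \<longleftrightarrow> (\<exists>d :: 'f + 'c \<Rightarrow> 'f + 'c \<Rightarrow> real.
     (\<forall>p\<in>F <+> C. d p p = 0) \<and>
     (\<forall>p\<in>F <+> C. \<forall>q\<in>F <+> C. 0 \<le> d p q \<and> d p q = d q p) \<and>
     (\<forall>p\<in>F <+> C. \<forall>q\<in>F <+> C. \<forall>r\<in>F <+> C. d p r \<le> d p q + d q r) \<and>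
     (\<forall>i\<in>F. \<forall>j\<in>C. c i j = d (Inl i) (Inr j)))"

definition lbfl_instance :: "('f, 'c) lbfl \<Rightarrow> bool" where
  "lbfl_instance I \<longleftrightarrow>
     finite (facilities I) \<and> finite (clients I) \<and>
     (\<forall>i\<in>facilities I. 0 \<le> opening_cost I i) \<and>
     metric_costs (facilities I) (clients I) (connection_cost I)"

definition lbfl_solutions :: "('f, 'c) lbfl \<Rightarrow> ('f set \<times> ('c \<Rightarrow> 'f)) set" where
  "lbfl_solutions I = {(S, \<sigma>). S \<subseteq> facilities I \<and> (\<forall>j\<in>clients I. \<sigma> j \<in> S) \<and>
     (\<forall>i\<in>S. lower_bound I \<le> card {j \<in> clients I. \<sigma> j = i})}"

definition lbfl_cost :: "('f, 'c) lbfl \<Rightarrow> 'f set \<times> ('c \<Rightarrow> 'f) \<Rightarrow> real" where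
  "lbfl_cost I = (\<lambda>(S, \<sigma>).
     (\<Sum>i\<in>S. opening_cost I i) + (\<Sum>j\<in>clients I. connection_cost I (\<sigma> j) j))"

definition lbfl_opt :: "('f, 'c) lbfl \<Rightarrow> ereal" where
  "lbfl_opt I = (INF s\<in>lbfl_solutions I. ereal (lbfl_cost I s))"


section \<open>The classic relaxation\<close>

datatype ('f, 'c) lp_var = OpenVar 'f | AssignVar 'f 'c

definition lp_vars :: "('f, 'c) lbfl \<Rightarrow> ('f, 'c) lp_var set" where
  "lp_vars I = OpenVar ` facilities I \<union> {AssignVar i j |i j. i \<in> facilities I \<and> j \<in> clients I}"

definition classic_ineqs :: "('f, 'c) lbfl \<Rightarrow> ('f, 'c) lp_var polynomial set" where
  "classic_ineqs I =
     {pvar (OpenVar i) - pvar (AssignVar i j) |i j. i \<in> facilities I \<and> j \<in> clients I} \<union>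
     {(\<Sum>j\<in>clients I. pvar (AssignVar i j)) - of_nat (lower_bound I) * pvar (OpenVar i) |i. i \<in> facilities I} \<union>
     {pvar v |v. v \<in> lp_vars I} \<union>
     {1 - pvar v |v. v \<in> lp_vars I}"

definition classic_eqs :: "('f, 'c) lbfl \<Rightarrow> ('f, 'c) lp_var polynomial set" where
  "classic_eqs I = {(\<Sum>i\<in>facilities I. pvar (AssignVar i j)) - 1 |j. j \<in> clients I}"

definition lp_cost :: "('f, 'c) lbfl \<Rightarrow> (('f, 'c) lp_var \<Rightarrow> real) \<Rightarrow> real" where
  "lp_cost I z = (\<Sum>i\<in>facilities I. opening_cost I i * z (OpenVar i)) +
     (\<Sum>i\<in>facilities I. \<Sum>j\<in>clients I. connection_cost I i j * z (AssignVar i j))"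

definition sa_classic :: "nat \<Rightarrow> ('f, 'c) lbfl \<Rightarrow> (('f, 'c) lp_var \<Rightarrow> real) set" where
  "sa_classic k I = sherali_adams k (lp_vars I) (classic_ineqs I) (classic_eqs I)"

text \<open>Level 0 is the original linear program.\<close>

lemma linearize_superset:
  "finite A \<Longrightarrow> Poly_Mapping.keys p \<subseteq> A \<Longrightarrow>
    linearize X p = (\<Sum>m\<in>A. Poly_Mapping.lookup p m * X (Poly_Mapping.keys m))"
  unfolding linearize_def by (rule sum.mono_neutral_left) (auto simp: in_keys_iff)

lemma linearize_add: "linearize X (p + q) = linearize X p + linearize X q"
proof -
  let ?A = "Poly_Mapping.keys p \<union> Poly_Mapping.keys q"
  have "Poly_Mapping.keys (p + q) \<subseteq> ?A"
    by (rule Poly_Mapping.keys_add)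
  then show ?thesis
    by (simp add: linearize_superset[of ?A] lookup_add sum.distrib distrib_right)
qed

lemma linearize_uminus: "linearize X (- p) = - linearize X p"
  by (simp add: linearize_def sum_negf)

lemma linearize_diff: "linearize X (p - q) = linearize X p - linearize X q"
  using linearize_add[of X p "- q"] by (simp add: linearize_uminus)

lemma linearize_zero: "linearize X 0 = 0"
  by (simp add: linearize_def)

lemma linearize_one: "linearize X 1 = X {}"
  by (simp add: linearize_def flip: single_one)

lemma linearize_sum: "linearize X (\<Sum>a\<in>A. p a) = (\<Sum>a\<in>A. linearize X (p a))"
  by (induction A rule: infinite_finite_induct) (simp_all add: linearize_zero linearize_add)

lemma linearize_of_nat_mult: "linearize X (of_nat n * p) = of_nat n * linearize X p"
  by (induction n) (simp_all add: linearize_zero linearize_add distrib_right)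

lemma linearize_pvar: "linearize X (pvar v) = X {v}"
  by (simp add: linearize_def pvar_def)

lemma sa_classic_0:
  "z \<in> sa_classic 0 I \<longleftrightarrow>
    (\<forall>i\<in>facilities I. \<forall>j\<in>clients I. z (AssignVar i j) \<le> z (OpenVar i)) \<and>
    (\<forall>j\<in>clients I. (\<Sum>i\<in>facilities I. z (AssignVar i j)) = 1) \<and>
    (\<forall>i\<in>facilities I. real (lower_bound I) * z (OpenVar i) \<le> (\<Sum>j\<in>clients I. z (AssignVar i j))) \<and>
    (\<forall>i\<in>facilities I. 0 \<le> z (OpenVar i) \<and> z (OpenVar i) \<le> 1) \<and>
    (\<forall>i\<in>facilities I. \<forall>j\<in>clients I. 0 \<le> z (AssignVar i j) \<and> z (AssignVar i j) \<le> 1)"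
    (is "_ \<longleftrightarrow> ?P z")
proof -
  have lift: "X \<in> sa_lifted 0 (lp_vars I) (classic_ineqs I) (classic_eqs I) \<longleftrightarrow>
      X {} = 1 \<and> (\<forall>g\<in>classic_ineqs I. 0 \<le> linearize X g) \<and> (\<forall>h\<in>classic_eqs I. linearize X h = 0)"
    for X
  proof -
    have "finite U \<and> U \<subseteq> lp_vars I \<and> card U \<le> 0 \<and> W \<subseteq> U \<longleftrightarrow> U = {} \<and> W = {}"
      for U W :: "('a, 'b) lp_var set"
      by auto
    then show ?thesis
      by (simp add: sa_lifted_def sa_multiplier_def)
  qed
  have vars: "(\<forall>v\<in>lp_vars I. Q v) \<longleftrightarrow> (\<forall>i\<in>facilities I. Q (OpenVar i)) \<and>
      (\<forall>i\<in>facilities I. \<forall>j\<in>clients I. Q (AssignVar i j))" for Q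
    unfolding lp_vars_def by blast
  have "(\<forall>g\<in>classic_ineqs I. Q g) \<longleftrightarrow>
      (\<forall>i\<in>facilities I. \<forall>j\<in>clients I. Q (pvar (OpenVar i) - pvar (AssignVar i j))) \<and>
      (\<forall>i\<in>facilities I. Q ((\<Sum>j\<in>clients I. pvar (AssignVar i j)) -
         of_nat (lower_bound I) * pvar (OpenVar i))) \<and>
      (\<forall>v\<in>lp_vars I. Q (pvar v)) \<and> (\<forall>v\<in>lp_vars I. Q (1 - pvar v))" for Q
    unfolding classic_ineqs_def by blast
  note G = this[where Q = "\<lambda>g. 0 \<le> linearize X g" for X, unfolded vars linearize_diff linearize_sum
      linearize_of_nat_mult linearize_pvar linearize_one]
  have "(\<forall>h\<in>classic_eqs I. Q h) \<longleftrightarrow>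
      (\<forall>j\<in>clients I. Q ((\<Sum>i\<in>facilities I. pvar (AssignVar i j)) - 1))" for Q
    unfolding classic_eqs_def by blast
  note H = this[where Q = "\<lambda>h. linearize X h = 0" for X, unfolded linearize_diff linearize_sum
      linearize_pvar linearize_one]
  have P: "X \<in> sa_lifted 0 (lp_vars I) (classic_ineqs I) (classic_eqs I) \<longleftrightarrow>
      X {} = 1 \<and> ?P (\<lambda>v. X {v})" for X
    unfolding lift G H by auto
  have cong: "?P z \<longleftrightarrow> ?P z'" if "\<forall>v\<in>lp_vars I. z v = z' v" for z z'
  proof -
    have "z (OpenVar i) = z' (OpenVar i)" if "i \<in> facilities I" for i
      using that \<open>\<forall>v\<in>lp_vars I. z v = z' v\<close> by (auto simp: lp_vars_def)
    moreover have "z (AssignVar i j) = z' (AssignVar i j)" if "i \<in> facilities I" "j \<in> clients I" for i j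
      using that \<open>\<forall>v\<in>lp_vars I. z v = z' v\<close> by (auto simp: lp_vars_def)
    ultimately show ?thesis
      by (simp cong: sum.cong ball_cong)
  qed
  show ?thesis
  proof
    assume "z \<in> sa_classic 0 I"
    then obtain X where X: "X \<in> sa_lifted 0 (lp_vars I) (classic_ineqs I) (classic_eqs I)"
      and zX: "\<forall>v\<in>lp_vars I. z v = X {v}"
      unfolding sa_classic_def sherali_adams_def by blast
    from X have "?P (\<lambda>v. X {v})"
      unfolding P by blast
    then show "?P z"
      unfolding cong[OF zX] .
  next
    assume z: "?P z"
    define X where "X S = (if S = {} then 1 else z (the_elem S))" for S
    have "X {} = 1 \<and> ?P (\<lambda>v. X {v})"
      using z by (simp add: X_def)
    then have "X \<in> sa_lifted 0 (lp_vars I) (classic_ineqs I) (classic_eqs I)"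
      unfolding P .
    then show "z \<in> sa_classic 0 I"
      unfolding sa_classic_def sherali_adams_def by (auto simp: X_def intro!: bexI[of _ X])
  qed
qed

definition sa_opt :: "nat \<Rightarrow> ('f, 'c) lbfl \<Rightarrow> ereal" where
  "sa_opt k I = (INF z\<in>sa_classic k I. ereal (lp_cost I z))"

text \<open>With the conventions of \<^typ>\<open>ereal\<close>, the gap is \<open>\<infinity>\<close> if the relaxation has value 0 and the
  integral optimum is positive, and 0 if both values are 0.\<close>

definition integrality_gap :: "nat \<Rightarrow> ('f, 'c) lbfl \<Rightarrow> ereal" where
  "integrality_gap k I = lbfl_opt I / sa_opt k I"

end

theory Submission imports Defs begin

text \<open>
  Put \<open>n\<close> locations at pairwise distance 1, each with one free facility and \<open>n\<^sup>3 - 1\<close> clients, and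
  take the lower bound \<open>n\<^sup>3\<close>. Not all facilities can be open in an integral solution, so the clients
  of a closed one all travel and the optimum is at least \<open>n\<^sup>3 - 1\<close>.

  For the relaxation, mix the \<open>n + 1\<close> assignments ``facility \<open>a\<close> closed, its clients spread evenly
  over the other facilities'' (each of weight \<open>2 / (n (n\<^sup>2 - 1))\<close>) and ``every facility open, every
  client at home'' (the remaining weight). Only the last one is infeasible, and there each load is
  short of the lower bound by 1. A literal over the variables that is true in it becomes false in at
  most one of the other assignments. A multiplier with \<open>k \<le> (n - 1) / 2\<close> literals that survives in
  it therefore survives in at least \<open>(n - 1) / 2\<close> feasible assignments that open a given facility,
  and their surplus load \<open>n\<^sup>2 + n\<close> compensates for the deficit. The mixture costs only \<open>O(n)\<close>.
\<close>

section \<open>Mixtures of integral points in the Sherali-Adams hierarchy\<close>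

text \<open>Linearizing with \<open>X S = of_bool (S \<subseteq> T)\<close> is evaluation at the 0-1 point with support \<open>T\<close>.\<close>

abbreviation eval_at :: "'v set \<Rightarrow> 'v polynomial \<Rightarrow> real" where
  "eval_at T \<equiv> linearize (\<lambda>S. of_bool (S \<subseteq> T))"

section \<open>Evaluation of polynomials at 0-1 points\<close>

lemma linearize_single: "linearize X (Poly_Mapping.single m c) = c * X (Poly_Mapping.keys m)"
  by (simp add: linearize_def)

lemma polynomial_eq_sum_single:
  fixes p :: "'v polynomial"
  shows "p = (\<Sum>m\<in>Poly_Mapping.keys p. Poly_Mapping.single m (Poly_Mapping.lookup p m))"
  by (rule poly_mapping_eqI) (simp add: lookup_sum lookup_single when_def in_keys_iff)

lemma keys_plus_nat:
  fixes m m' :: "'v \<Rightarrow>\<^sub>0 nat"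
  shows "Poly_Mapping.keys (m + m') = Poly_Mapping.keys m \<union> Poly_Mapping.keys m'"
  by (auto simp: in_keys_iff lookup_add)

text \<open>Supports of monomials unite under multiplication, and a union lies in \<open>T\<close>
  iff both parts do, so evaluation is multiplicative on monomials; bilinearity does the
  rest.\<close>

lemma eval_at_mult: "eval_at T (p * q) = eval_at T p * eval_at T q"
proof -
  have "p * q = (\<Sum>m\<in>Poly_Mapping.keys p. \<Sum>m'\<in>Poly_Mapping.keys q.
      Poly_Mapping.single m (Poly_Mapping.lookup p m) *
        Poly_Mapping.single m' (Poly_Mapping.lookup q m'))"
    using arg_cong2[OF polynomial_eq_sum_single[of p] polynomial_eq_sum_single[of q], of "(*)"]
    unfolding sum_product .
  then have "eval_at T (p * q) = (\<Sum>m\<in>Poly_Mapping.keys p. \<Sum>m'\<in>Poly_Mapping.keys q.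
      eval_at T (Poly_Mapping.single m (Poly_Mapping.lookup p m) *
        Poly_Mapping.single m' (Poly_Mapping.lookup q m')))"
    by (simp only: linearize_sum)
  also have "\<dots> = eval_at T p * eval_at T q"
    unfolding mult_single linearize_single keys_plus_nat Un_subset_iff of_bool_conj
    by (simp only: linearize_def sum_product mult_ac)
  finally show ?thesis .
qed

lemma eval_at_prod: "eval_at T (\<Prod>a\<in>A. p a) = (\<Prod>a\<in>A. eval_at T (p a))"
  by (induction A rule: infinite_finite_induct) (simp_all add: linearize_one eval_at_mult)

lemma eval_at_pvar: "eval_at T (pvar v) = of_bool (v \<in> T)"
  by (simp add: linearize_pvar)

text \<open>The multiplier is a product of literals, each 0 or 1 at \<open>T\<close>; the set
  equation says that all of them are true there.\<close>

lemma eval_at_sa_multiplier: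
  assumes "finite U" "W \<subseteq> U"
  shows "eval_at T (sa_multiplier U W) = of_bool (U \<inter> T = U - W)"
proof -
  have W: "finite W"
    using assms finite_subset by blast
  have "(\<Prod>v\<in>U - W. of_bool (v \<in> T) :: real) = of_bool (U - W \<subseteq> T)"
  proof (cases "U - W \<subseteq> T")
    case True
    then show ?thesis
      by (simp, intro prod.neutral) auto
  qed (use assms(1) in auto)
  moreover have "(\<Prod>v\<in>W. 1 - of_bool (v \<in> T) :: real) = of_bool (W \<inter> T = {})"
  proof (cases "W \<inter> T = {}")
    case True
    then show ?thesis
      by (simp, intro prod.neutral) auto
  qed (use W in \<open>auto simp: prod_zero_iff\<close>)
  moreover have "U \<inter> T = U - W \<longleftrightarrow> U - W \<subseteq> T \<and> W \<inter> T = {}"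
    using assms(2) by blast
  ultimately show ?thesis
    by (simp add: sa_multiplier_def eval_at_mult eval_at_prod linearize_diff linearize_one
        eval_at_pvar of_bool_conj)
qed

text \<open>Linearization is also linear in the lifted values, so a lifted constraint can be checked
  on a mixture by averaging over its points.\<close>

lemma linearize_mixture:
  "linearize (\<lambda>S. \<Sum>\<omega>\<in>\<Omega>. p \<omega> * X \<omega> S) q = (\<Sum>\<omega>\<in>\<Omega>. p \<omega> * linearize (X \<omega>) q)"
  unfolding linearize_def sum_distrib_left by (subst sum.swap) (simp add: mult_ac)

section \<open>Facility location assignments as 0-1 points\<close>

definition true_vars :: "'f set \<times> ('c \<Rightarrow> 'f) \<Rightarrow> ('f, 'c) lp_var set" where
  "true_vars = (\<lambda>(S, \<sigma>). OpenVar ` S \<union> {AssignVar (\<sigma> j) j |j. True})"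

lemma OpenVar_in_true_vars [simp]: "OpenVar i \<in> true_vars s \<longleftrightarrow> i \<in> fst s"
  by (auto simp: true_vars_def split: prod.splits)

lemma AssignVar_in_true_vars [simp]: "AssignVar i j \<in> true_vars s \<longleftrightarrow> snd s j = i"
  by (auto simp: true_vars_def split: prod.splits)

text \<open>Every constraint except the lower bound holds at each point and thus survives any
  nonnegative multiplier. The lower bound may fail at single points, provided that it holds on
  average over the points where the multiplier is 1.\<close>

lemma sa_classic_mixture:
  fixes I :: "('f, 'c) lbfl" and s :: "'w \<Rightarrow> 'f set \<times> ('c \<Rightarrow> 'f)" and p :: "'w \<Rightarrow> real"
  assumes fin: "finite (facilities I)" "finite (clients I)"
    and p: "\<And>\<omega>. \<omega> \<in> \<Omega> \<Longrightarrow> 0 \<le> p \<omega>" "(\<Sum>\<omega>\<in>\<Omega>. p \<omega>) = 1"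
    and s: "\<And>\<omega>. \<omega> \<in> \<Omega> \<Longrightarrow> fst (s \<omega>) \<subseteq> facilities I"
      "\<And>\<omega> j. \<omega> \<in> \<Omega> \<Longrightarrow> j \<in> clients I \<Longrightarrow> snd (s \<omega>) j \<in> fst (s \<omega>)"
    and load: "\<And>i U W. i \<in> facilities I \<Longrightarrow> U \<subseteq> lp_vars I \<Longrightarrow> finite U \<Longrightarrow> card U \<le> k \<Longrightarrow> W \<subseteq> U \<Longrightarrow>
      0 \<le> (\<Sum>\<omega>\<in>\<Omega>. p \<omega> * ((real (card {j \<in> clients I. snd (s \<omega>) j = i}) -
        real (lower_bound I) * of_bool (i \<in> fst (s \<omega>))) * of_bool (U \<inter> true_vars (s \<omega>) = U - W)))"
  shows "(\<lambda>v. \<Sum>\<omega>\<in>\<Omega>. p \<omega> * of_bool (v \<in> true_vars (s \<omega>))) \<in> sa_classic k I"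
proof -
  define X where "X S = (\<Sum>\<omega>\<in>\<Omega>. p \<omega> * of_bool (S \<subseteq> true_vars (s \<omega>)))" for S
  have lin: "linearize X (g * sa_multiplier U W) =
      (\<Sum>\<omega>\<in>\<Omega>. p \<omega> * (eval_at (true_vars (s \<omega>)) g * of_bool (U \<inter> true_vars (s \<omega>) = U - W)))"
    if "finite U" "W \<subseteq> U" for g U W
    using that by (simp add: X_def[abs_def] linearize_mixture eval_at_mult eval_at_sa_multiplier)
  have nonneg: "0 \<le> linearize X (g * sa_multiplier U W)"
    if "finite U" "W \<subseteq> U" "\<And>\<omega>. \<omega> \<in> \<Omega> \<Longrightarrow> 0 \<le> eval_at (true_vars (s \<omega>)) g" for g U W
    unfolding lin[OF that(1,2)] using that(3) p(1) by (intro sum_nonneg) simp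
  have ineq: "0 \<le> linearize X (g * sa_multiplier U W)"
    if U: "finite U" "U \<subseteq> lp_vars I" "card U \<le> k" "W \<subseteq> U" and g: "g \<in> classic_ineqs I" for g U W
  proof -
    consider (assign) i j where "g = pvar (OpenVar i) - pvar (AssignVar i j)"
        "i \<in> facilities I" "j \<in> clients I"
      | (load) i where "g = (\<Sum>j\<in>clients I. pvar (AssignVar i j)) -
          of_nat (lower_bound I) * pvar (OpenVar i)" "i \<in> facilities I"
      | (var) v where "g = pvar v" | (one) v where "g = 1 - pvar v"
      using g unfolding classic_ineqs_def by blast
    then show ?thesis
    proof cases
      case assign
      then show ?thesis
        using s(2) by (intro nonneg U) (auto simp: linearize_diff eval_at_pvar)
    next
      case load
      have "(\<Sum>j\<in>clients I. of_bool (snd (s \<omega>) j = i)) =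
          real (card {j \<in> clients I. snd (s \<omega>) j = i})" for \<omega>
        using fin(2) by (simp add: sum_of_bool_eq Int_def)
      then show ?thesis
        using assms(7)[OF load(2) U(2,1,3,4)]
        by (simp add: lin U load linearize_diff linearize_sum linearize_of_nat_mult eval_at_pvar)
    qed (intro nonneg U; simp add: linearize_diff linearize_one eval_at_pvar)+
  qed
  have eq: "linearize X (h * sa_multiplier U W) = 0"
    if U: "finite U" "W \<subseteq> U" and h: "h \<in> classic_eqs I" for h U W
  proof -
    obtain j where j: "h = (\<Sum>i\<in>facilities I. pvar (AssignVar i j)) - 1" "j \<in> clients I"
      using h unfolding classic_eqs_def by blast
    have "eval_at (true_vars (s \<omega>)) h = 0" if "\<omega> \<in> \<Omega>" for \<omega>
    proof -
      have "snd (s \<omega>) j \<in> facilities I"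
        using s that j by blast
      then have "(\<Sum>i\<in>facilities I. of_bool (snd (s \<omega>) j = i) :: real) = 1"
        using fin(1) by (simp add: of_bool_def)
      then show ?thesis
        by (simp add: j linearize_diff linearize_sum linearize_one eval_at_pvar)
    qed
    then show ?thesis
      by (simp add: lin U)
  qed
  have "X {} = 1"
    using p(2) by (simp add: X_def)
  then have "X \<in> sa_lifted k (lp_vars I) (classic_ineqs I) (classic_eqs I)"
    unfolding sa_lifted_def using ineq eq by blast
  then show ?thesis
    unfolding sa_classic_def sherali_adams_def by (auto simp: X_def intro!: bexI[of _ X])
qed

lemma sa_classic_AssignVar_nonneg:
  assumes "z \<in> sa_classic k I" "i \<in> facilities I" "j \<in> clients I"
  shows "0 \<le> z (AssignVar i j)"
proof -
  have v: "AssignVar i j \<in> lp_vars I"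
    using assms by (auto simp: lp_vars_def)
  then have "pvar (AssignVar i j) \<in> classic_ineqs I"
    unfolding classic_ineqs_def by blast
  moreover obtain X where X: "X \<in> sa_lifted k (lp_vars I) (classic_ineqs I) (classic_eqs I)"
    and "z (AssignVar i j) = X {AssignVar i j}"
    using assms(1) v unfolding sa_classic_def sherali_adams_def by blast
  \<comment> \<open>The empty multiplier gives back the original constraint.\<close>
  moreover have "0 \<le> linearize X (g * sa_multiplier {} {})" if "g \<in> classic_ineqs I" for g
    using X that unfolding sa_lifted_def by (force dest!: spec[of _ "{}"])
  ultimately show ?thesis
    by (force simp: sa_multiplier_def linearize_pvar)
qed

section \<open>The instances\<close>

text \<open>Clients are numbered in consecutive blocks of \<open>n ^ 3 - 1\<close>, one block per
  location.\<close>

definition home :: "nat \<Rightarrow> nat \<Rightarrow> nat" where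
  "home n j = j div (n ^ 3 - 1)"

definition gap_instance :: "nat \<Rightarrow> (nat, nat) lbfl" where
  "gap_instance n = \<lparr>facilities = {..<n}, clients = {..<n ^ 4 - n}, opening_cost = (\<lambda>i. 0),
     connection_cost = (\<lambda>i j. of_bool (home n j \<noteq> i)), lower_bound = n ^ 3\<rparr>"

lemma gap_instance_simps [simp]:
  "facilities (gap_instance n) = {..<n}"
  "clients (gap_instance n) = {..<n ^ 4 - n}"
  "opening_cost (gap_instance n) i = 0"
  "connection_cost (gap_instance n) i j = of_bool (home n j \<noteq> i)"
  "lower_bound (gap_instance n) = n ^ 3"
  by (simp_all add: gap_instance_def)

lemma lbfl_instance_gap_instance: "lbfl_instance (gap_instance n)"
proof -
  define loc where "loc = case_sum (\<lambda>i. i) (home n)"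
  have "metric_costs {..<n} {..<n ^ 4 - n} (\<lambda>i j. of_bool (home n j \<noteq> i))"
    unfolding metric_costs_def
    \<comment> \<open>The discrete metric on locations, pulled back to facilities and
      clients.\<close>
    by (rule exI[of _ "\<lambda>p q. of_bool (loc p \<noteq> loc q)"]) (auto simp: loc_def)
  then show ?thesis
    by (simp add: lbfl_instance_def gap_instance_def)
qed

lemma card_clients_eq: "n ^ 4 - n = n * (n ^ 3 - 1)" for n :: nat
  by (simp add: diff_mult_distrib2 power_Suc[symmetric] del: power_Suc)

text \<open>A block can therefore be split evenly among the \<open>n - 1\<close> other
  facilities.\<close>

lemma cube_minus_1: "n ^ 3 - 1 = (n - 1) * (n\<^sup>2 + n + 1)" for n :: nat
  by (cases n) (simp_all add: power2_eq_square power3_eq_cube algebra_simps)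

lemma home_less: "j < n ^ 4 - n \<Longrightarrow> home n j < n"
  unfolding home_def card_clients_eq by (rule less_mult_imp_div_less)

lemma card_home:
  assumes "n \<ge> 2" "i < n"
  shows "card {j \<in> {..<n ^ 4 - n}. home n j = i} = n ^ 3 - 1"
proof -
  define m where "m = n ^ 3 - 1"
  have m: "m > 0"
    using assms one_less_power[of n 3] by (simp add: m_def)
  have "Suc i * m \<le> n * m"
    using assms by (intro mult_le_mono1) simp
  then have "{j \<in> {..<n ^ 4 - n}. home n j = i} = {i * m..<Suc i * m}"
    unfolding home_def card_clients_eq m_def[symmetric]
    using m by (auto simp: less_mult_imp_div_less div_nat_eqI mult.commute dividend_less_times_div
        intro: less_le_trans)
  then show ?thesis
    by (simp add: m_def)
qed

section \<open>The integral assignments and their loads\<close>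

text \<open>The residue modulo \<open>n - 1\<close> numbers the facilities other than
  \<open>a\<close>, skipping \<open>a\<close>.\<close>

definition reassign :: "nat \<Rightarrow> nat \<Rightarrow> nat \<Rightarrow> nat" where
  "reassign n a j = (if home n j = a
     then let t = j mod (n - 1) in if t < a then t else t + 1
     else home n j)"

text \<open>For \<open>a = n\<close> all facilities are open and all clients are served at home.\<close>

definition outcome :: "nat \<Rightarrow> nat \<Rightarrow> nat set \<times> (nat \<Rightarrow> nat)" where
  "outcome n a = ({..<n} - {a}, reassign n a)"

lemma reassign_open:
  assumes "n \<ge> 2" "j < n ^ 4 - n"
  shows "reassign n a j \<in> {..<n} - {a}"
proof -
  have "j mod (n - 1) + 1 < n"
    using assms mod_less_divisor[of "n - 1" j] by linarith
  then show ?thesis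
    using home_less[OF assms(2)] assms(1) by (auto simp: reassign_def Let_def)
qed

lemma card_reassigned_ge:
  assumes "n \<ge> 2" "a < n" "i < n" "i \<noteq> a"
  shows "n\<^sup>2 + n + 1 \<le> card {j \<in> {..<n ^ 4 - n}. home n j = a \<and> reassign n a j = i}"
proof -
  \<comment> \<open>\<open>t\<close> is the residue that \<open>reassign\<close> sends to
    \<open>i\<close>; \<open>q\<close> counts the clients of the block with this residue, and
    \<open>f\<close> below lists them.\<close>
  define t where "t = (if i < a then i else i - 1)"
  define q where "q = n\<^sup>2 + n + 1"
  have t: "t < n - 1"
    using assms by (auto simp: t_def)
  define f where "f s = a * (n ^ 3 - 1) + ((n - 1) * s + t)" for s
  have m: "n ^ 3 - 1 = (n - 1) * q"
    unfolding q_def by (rule cube_minus_1)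
  have fs: "f s < n ^ 4 - n \<and> home n (f s) = a \<and> reassign n a (f s) = i" if "s < q" for s
  proof -
    have "(n - 1) * s + t < (n - 1) * Suc s"
      using t by simp
    also have "\<dots> \<le> (n - 1) * q"
      using that by (intro mult_le_mono2) simp
    finally have less: "(n - 1) * s + t < n ^ 3 - 1"
      by (simp only: m)
    then have h: "home n (f s) = a"
      by (simp add: home_def f_def)
    have "f s < Suc a * (n ^ 3 - 1)"
      using less by (simp add: f_def)
    also have "\<dots> \<le> n * (n ^ 3 - 1)"
      using assms by (intro mult_le_mono1) simp
    finally have "f s < n ^ 4 - n"
      by (simp add: card_clients_eq)
    \<comment> \<open>The block starts at a multiple of \<open>n - 1\<close>, so the offset inside
      the block determines the residue.\<close>
    moreover have "f s = t + (n - 1) * (a * q + s)"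
      unfolding f_def m by (simp only: distrib_left ac_simps)
    then have "f s mod (n - 1) = t"
      using t by simp
    then have "reassign n a (f s) = i"
      using h assms by (auto simp: reassign_def t_def Let_def)
    ultimately show ?thesis
      using h by blast
  qed
  have "inj_on f {..<q}"
    using t by (auto simp: inj_on_def f_def)
  then have "q = card (f ` {..<q})"
    by (simp add: card_image)
  also have "\<dots> \<le> card {j \<in> {..<n ^ 4 - n}. home n j = a \<and> reassign n a j = i}"
    using fs by (intro card_mono) auto
  finally show ?thesis
    by (simp add: q_def)
qed

text \<open>An open facility keeps its \<open>n ^ 3 - 1\<close> home clients and gains its share of
  the block of \<open>a\<close>; one client of that share fills the gap to the lower bound, the
  others are surplus.\<close>

lemma load_feasible:
  assumes "n \<ge> 2" "a < n" "i < n" "i \<noteq> a"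
  shows "n ^ 3 + (n\<^sup>2 + n) \<le> card {j \<in> {..<n ^ 4 - n}. reassign n a j = i}"
proof -
  let ?A = "{j \<in> {..<n ^ 4 - n}. home n j = i}"
  let ?B = "{j \<in> {..<n ^ 4 - n}. home n j = a \<and> reassign n a j = i}"
  have "n ^ 3 > 0"
    using assms by simp
  then have "n ^ 3 + (n\<^sup>2 + n) = (n ^ 3 - 1) + (n\<^sup>2 + n + 1)"
    by linarith
  also have "\<dots> \<le> card ?A + card ?B"
    using card_home[of n i] card_reassigned_ge[of n a i] assms by simp
  also have "\<dots> = card (?A \<union> ?B)"
    using assms by (intro card_Un_disjoint[symmetric]) auto
  also have "\<dots> \<le> card {j \<in> {..<n ^ 4 - n}. reassign n a j = i}"
    using assms by (intro card_mono) (auto simp: reassign_def)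
  finally show ?thesis .
qed

lemma load_all_open:
  assumes "n \<ge> 2" "i < n"
  shows "card {j \<in> {..<n ^ 4 - n}. reassign n n j = i} = n ^ 3 - 1"
proof -
  have "{j \<in> {..<n ^ 4 - n}. reassign n n j = i} = {j \<in> {..<n ^ 4 - n}. home n j = i}"
    using home_less by (fastforce simp: reassign_def)
  then show ?thesis
    using card_home[OF assms] by simp
qed

lemma outcome_solution:
  assumes "n \<ge> 2" "a < n"
  shows "outcome n a \<in> lbfl_solutions (gap_instance n)"
proof -
  have "n ^ 3 \<le> card {j \<in> {..<n ^ 4 - n}. reassign n a j = i}" if "i \<in> {..<n} - {a}" for i
    using load_feasible[OF assms, of i] that by simp
  then show ?thesis
    using reassign_open[OF assms(1)] by (simp add: lbfl_solutions_def outcome_def)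
qed

section \<open>The integral optimum\<close>

lemma lbfl_opt_ge:
  assumes "n \<ge> 2"
  shows "ereal (real (n ^ 3 - 1)) \<le> lbfl_opt (gap_instance n)"
  unfolding lbfl_opt_def
proof (rule INF_greatest)
  fix s assume "s \<in> lbfl_solutions (gap_instance n)"
  then obtain S \<sigma> where s: "s = (S, \<sigma>)" and S: "S \<subseteq> {..<n}"
    and \<sigma>: "\<And>j. j < n ^ 4 - n \<Longrightarrow> \<sigma> j \<in> S"
    and lb: "\<And>i. i \<in> S \<Longrightarrow> n ^ 3 \<le> card {j \<in> {..<n ^ 4 - n}. \<sigma> j = i}"
    by (auto simp: lbfl_solutions_def)
  \<comment> \<open>Opening all facilities would need \<open>n * n ^ 3\<close> clients, but only
    \<open>n * (n ^ 3 - 1)\<close> exist.\<close>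
  have "S \<noteq> {..<n}"
  proof
    assume "S = {..<n}"
    then have "(\<Sum>i<n. n ^ 3) \<le> (\<Sum>i<n. card {j \<in> {..<n ^ 4 - n}. \<sigma> j = i})"
      using lb by (intro sum_mono) auto
    also have "\<dots> = card (\<Union>i<n. {j \<in> {..<n ^ 4 - n}. \<sigma> j = i})"
      by (intro card_UN_disjoint[symmetric]) auto
    also have "\<dots> \<le> card {..<n ^ 4 - n}"
      by (intro card_mono) auto
    finally have "n * n ^ 3 \<le> n * (n ^ 3 - 1)"
      by (simp add: card_clients_eq)
    moreover have "n * (n ^ 3 - 1) < n * n ^ 3"
      using assms by (intro mult_strict_left_mono) auto
    ultimately show False
      by linarith
  qed
  then obtain a where a: "a < n" "a \<notin> S"
    using S by blast
  \<comment> \<open>The clients at home in the closed \<open>a\<close> are served elsewhere and pay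
    1 each.\<close>
  have "real (n ^ 3 - 1) = (\<Sum>j<n ^ 4 - n. of_bool (home n j = a))"
    using card_home[OF assms a(1)] by (simp add: sum_of_bool_eq Int_def)
  also have "\<dots> \<le> (\<Sum>j<n ^ 4 - n. of_bool (home n j \<noteq> \<sigma> j))"
    using \<sigma> a(2) by (intro sum_mono) auto
  also have "\<dots> = lbfl_cost (gap_instance n) s"
    by (simp add: s lbfl_cost_def)
  finally show "ereal (real (n ^ 3 - 1)) \<le> ereal (lbfl_cost (gap_instance n) s)"
    by simp
qed

section \<open>The fractional solution\<close>

text \<open>Chosen so that a surplus of \<open>n^2 + n\<close> in \<open>(n - 1) / 2\<close>
  outcomes of this weight adds up to exactly 1.\<close>

definition weight :: "nat \<Rightarrow> real" where
  "weight n = 2 / (real n * ((real n)\<^sup>2 - 1))"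

definition prob :: "nat \<Rightarrow> nat \<Rightarrow> real" where
  "prob n a = (if a < n then weight n else 1 - real n * weight n)"

lemma weight_bounds:
  assumes "n \<ge> 2"
  shows "0 < weight n" "real n * weight n \<le> 1"
proof -
  \<comment> \<open>The second bound reads \<open>2 / (n^2 - 1) \<le> 1\<close>.\<close>
  have "4 \<le> (real n)\<^sup>2"
    using assms power_mono[of 2 "real n" 2] by simp
  then show "0 < weight n" "real n * weight n \<le> 1"
    using assms by (auto simp: weight_def field_simps)
qed

text \<open>Closing \<open>a\<close> affects only the opening of \<open>a\<close> and the service of
  the clients at home in \<open>a\<close>, so each variable can be flipped by one closure
  only.\<close>

lemma flipped_literal_closed_facility:
  assumes "v \<in> lp_vars (gap_instance n)" "a < n"
    and "v \<in> true_vars (outcome n n) \<longleftrightarrow> v \<notin> true_vars (outcome n a)"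
  shows "a = (case v of OpenVar i \<Rightarrow> i | AssignVar i j \<Rightarrow> home n j)"
proof (cases v)
  case (OpenVar i)
  then show ?thesis
    using assms by (auto simp: lp_vars_def outcome_def)
next
  case (AssignVar i j)
  then have "home n j \<noteq> n"
    using assms(1) home_less[of j n] by (auto simp: lp_vars_def)
  then have "reassign n n j = home n j"
    by (simp add: reassign_def)
  moreover have "reassign n a j = home n j" if "home n j \<noteq> a"
    using that by (simp add: reassign_def)
  ultimately show ?thesis
    using assms(3) AssignVar by (auto simp: outcome_def)
qed

lemma card_killed_le:
  assumes "U \<subseteq> lp_vars (gap_instance n)" "finite U"
  shows "card {a. a < n \<and> U \<inter> true_vars (outcome n a) \<noteq> U \<inter> true_vars (outcome n n)} \<le> card U"
proof -
  let ?g = "\<lambda>v. case v of OpenVar i \<Rightarrow> i | AssignVar i j \<Rightarrow> home n j"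
  have "{a. a < n \<and> U \<inter> true_vars (outcome n a) \<noteq> U \<inter> true_vars (outcome n n)} \<subseteq> ?g ` U"
    using flipped_literal_closed_facility assms(1) by blast
  then show ?thesis
    using assms(2) by (meson card_image_le card_mono finite_imageI le_trans)
qed

text \<open>If the multiplier is 0 in the all-open outcome, only nonnegative terms remain; otherwise
  the surplus of the surviving outcomes has to pay for the deficit there.\<close>

lemma mixture_load:
  assumes n: "n \<ge> 2" and i: "i < n"
    and U: "U \<subseteq> lp_vars (gap_instance n)" "finite U" "card U \<le> (n - 1) div 2"
  shows "0 \<le> (\<Sum>a\<le>n. prob n a * ((real (card {j \<in> {..<n ^ 4 - n}. reassign n a j = i}) -
    real (n ^ 3) * of_bool (i \<in> {..<n} - {a})) * of_bool (U \<inter> true_vars (outcome n a) = U - W)))"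
    (is "0 \<le> (\<Sum>a\<le>n. prob n a * (?e a * ?M a))")
proof -
  have split: "(\<Sum>a\<le>n. prob n a * (?e a * ?M a)) =
      (\<Sum>a<n. weight n * (?e a * ?M a)) + (1 - real n * weight n) * (?e n * ?M n)"
    by (simp add: lessThan_Suc_atMost[symmetric] prob_def)
  \<comment> \<open>The indicator drops the outcome \<open>a = i\<close>: there facility
    \<open>i\<close> is closed and its slack is merely nonnegative.\<close>
  have e: "real (n\<^sup>2 + n) * of_bool (a \<noteq> i) \<le> ?e a" if "a < n" for a
  proof (cases "a = i")
    case False
    then have "real (n ^ 3 + (n\<^sup>2 + n)) \<le> real (card {j \<in> {..<n ^ 4 - n}. reassign n a j = i})"
      using load_feasible[of n a i] n that i by (intro of_nat_mono) auto
    then show ?thesis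
      using False i by simp
  qed simp
  have e0: "0 \<le> ?e a" if "a < n" for a
    using e[OF that] by (rule order_trans[rotated]) simp
  have en: "?e n = -1"
    unfolding load_all_open[OF n i] using n i by (simp add: of_nat_diff)
  note w = weight_bounds[OF n]
  show ?thesis
  proof (cases "U \<inter> true_vars (outcome n n) = U - W")
    case False
    then show ?thesis
      unfolding split using w e0 by (auto intro!: sum_nonneg mult_nonneg_nonneg)
  next
    case True
    let ?K = "{a. a < n \<and> U \<inter> true_vars (outcome n a) \<noteq> U \<inter> true_vars (outcome n n)}"
    \<comment> \<open>Outcomes that leave \<open>i\<close> open and agree with the all-open one on
      \<open>U\<close>; at least \<open>n - 1 - (n - 1) div 2\<close> of them exist.\<close>
    let ?A = "{..<n} - insert i ?K"
    have "card (insert i ?K) \<le> 1 + (n - 1) div 2"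
      using card_killed_le[OF U(1,2)] U(3) by (simp add: card_insert_if)
    then have "n \<le> card ?A + (1 + (n - 1) div 2)"
      using diff_card_le_card_Diff[of "insert i ?K" "{..<n}"] by simp
    then have "n \<le> 2 * card ?A + 1"
      using n by presburger
    then have "real n \<le> real (2 * card ?A + 1)"
      by (rule of_nat_mono)
    then have A: "(real n - 1) / 2 \<le> real (card ?A)"
      by simp
    have "1 = weight n * (real (n\<^sup>2 + n) * ((real n - 1) / 2))"
      using w(1) n by (simp add: weight_def power2_eq_square field_simps)
    also have "\<dots> \<le> weight n * (real (n\<^sup>2 + n) * real (card ?A))"
      using w(1) A by (intro mult_left_mono) auto
    also have "\<dots> = (\<Sum>a\<in>?A. weight n * real (n\<^sup>2 + n))"
      by simp
    also have "\<dots> \<le> (\<Sum>a\<in>?A. weight n * (?e a * ?M a))"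
      using e w(1) True by (intro sum_mono mult_left_mono) fastforce+
    \<comment> \<open>By \<open>e0\<close> the outcomes outside \<open>?A\<close> add nonnegative
      terms.\<close>
    also have "\<dots> \<le> (\<Sum>a<n. weight n * (?e a * ?M a))"
      using w(1) e0 by (intro sum_mono2) auto
    finally have "1 \<le> (\<Sum>a<n. weight n * (?e a * ?M a))" .
    \<comment> \<open>The all-open outcome thus has weight at most 1, and so has its weighted
      deficit.\<close>
    moreover have "0 \<le> real n * weight n"
      using w(1) by simp
    ultimately show ?thesis
      unfolding split en using True by simp
  qed
qed

section \<open>The mixture as a point of the relaxation, its cost and the gap\<close>

definition frac_solution :: "nat \<Rightarrow> (nat, nat) lp_var \<Rightarrow> real" where
  "frac_solution n v = (\<Sum>a\<le>n. prob n a * of_bool (v \<in> true_vars (outcome n a)))"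

lemma frac_solution_in_sa_classic:
  assumes "n \<ge> 2"
  shows "frac_solution n \<in> sa_classic ((n - 1) div 2) (gap_instance n)"
  unfolding frac_solution_def[abs_def]
proof (rule sa_classic_mixture)
  show "0 \<le> prob n a" for a
    using weight_bounds[OF assms] by (simp add: prob_def)
  show "(\<Sum>a\<le>n. prob n a) = 1"
    by (simp add: lessThan_Suc_atMost[symmetric] prob_def)
  show "snd (outcome n a) j \<in> fst (outcome n a)" if "j \<in> clients (gap_instance n)" for a j
    using reassign_open[OF assms, of j a] that by (simp add: outcome_def)
qed (use mixture_load[OF assms] in \<open>auto simp: outcome_def\<close>)

text \<open>A client pays only in the outcome that closes its home, and pays 1 there, so its
  expected cost is the weight of that outcome.\<close>

lemma lp_cost_frac_solution:
  assumes "n \<ge> 2"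
  shows "lp_cost (gap_instance n) (frac_solution n) = weight n * real (n ^ 4 - n)"
proof -
  have "(\<Sum>i<n. of_bool (home n j \<noteq> i) * frac_solution n (AssignVar i j)) = weight n"
    if j: "j < n ^ 4 - n" for j
  proof -
    have "(\<Sum>i<n. of_bool (home n j \<noteq> i) * frac_solution n (AssignVar i j)) =
        (\<Sum>a\<le>n. prob n a * (\<Sum>i<n. of_bool (home n j \<noteq> i) * of_bool (reassign n a j = i)))"
      unfolding frac_solution_def sum_distrib_left
      by (subst sum.swap) (simp add: outcome_def mult_ac)
    also have "\<dots> = (\<Sum>a\<le>n. prob n a * of_bool (home n j = a))"
    proof (rule sum.cong[OF refl])
      fix a
      have r: "reassign n a j < n" "reassign n a j \<noteq> a"
        using reassign_open[OF assms j, of a] by auto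
      have "(\<Sum>i<n. of_bool (home n j \<noteq> i) * of_bool (reassign n a j = i)) =
          (\<Sum>i<n. if reassign n a j = i then of_bool (home n j \<noteq> i) else (0 :: real))"
        by (intro sum.cong) auto
      also have "\<dots> = of_bool (home n j \<noteq> reassign n a j)"
        using r(1) by simp
      also have "home n j \<noteq> reassign n a j \<longleftrightarrow> home n j = a"
        using r(2) by (auto simp: reassign_def)
      finally show "prob n a * (\<Sum>i<n. of_bool (home n j \<noteq> i) * of_bool (reassign n a j = i)) =
          prob n a * of_bool (home n j = a)"
        by simp
    qed
    also have "\<dots> = (\<Sum>a\<le>n. if home n j = a then prob n a else 0)"
      by (intro sum.cong) auto
    also have "\<dots> = weight n"
      using home_less[OF j] by (simp add: prob_def)
    finally show ?thesis .
  qed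
  then have "(\<Sum>j<n ^ 4 - n. \<Sum>i<n. of_bool (home n j \<noteq> i) * frac_solution n (AssignVar i j)) =
      (\<Sum>j<n ^ 4 - n. weight n)"
    by (intro sum.cong) auto
  moreover have "lp_cost (gap_instance n) (frac_solution n) =
      (\<Sum>j<n ^ 4 - n. \<Sum>i<n. of_bool (home n j \<noteq> i) * frac_solution n (AssignVar i j))"
    by (subst sum.swap) (simp add: lp_cost_def)
  ultimately show ?thesis
    by simp
qed

lemma sa_opt_le:
  assumes "n \<ge> 2"
  shows "sa_opt ((n - 1) div 2) (gap_instance n) \<le> ereal (2 * (real n + 1))"
proof -
  have r: "real (n ^ 4 - n) = real n * (real n - 1) * ((real n)\<^sup>2 + real n + 1)"
    using assms unfolding card_clients_eq cube_minus_1
    by (simp add: of_nat_diff power2_eq_square algebra_simps)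
  have w: "(real n)\<^sup>2 - 1 = (real n - 1) * (real n + 1)"
    by (simp add: power2_eq_square algebra_simps)
  have "weight n * real (n ^ 4 - n) = 2 * ((real n)\<^sup>2 + real n + 1) / (real n + 1)"
    using assms unfolding r weight_def w
    by (simp add: divide_simps)
  also have "\<dots> \<le> 2 * (real n + 1)"
    by (simp add: power2_eq_square field_simps)
  finally have "lp_cost (gap_instance n) (frac_solution n) \<le> 2 * (real n + 1)"
    by (simp add: lp_cost_frac_solution assms)
  then show ?thesis
    unfolding sa_opt_def using frac_solution_in_sa_classic[OF assms]
    by (intro INF_lower2) auto
qed

text \<open>Needed to invert the upper bound on the relaxation: inversion in \<open>ereal\<close> is
  antitone on nonnegative values.\<close>

lemma sa_opt_nonneg: "0 \<le> sa_opt k (gap_instance n)"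
  unfolding sa_opt_def lp_cost_def
  by (intro INF_greatest) (auto intro!: sum_nonneg dest: sa_classic_AssignVar_nonneg)

lemma integrality_gap_ge:
  assumes "n \<ge> 2"
  shows "ereal (real (n - 1) / 2) \<le> integrality_gap ((n - 1) div 2) (gap_instance n)"
proof -
  let ?sa = "sa_opt ((n - 1) div 2) (gap_instance n)"
  have nonzero: "2 * (real n + 1) = 0 \<longleftrightarrow> False"
    by simp
  have "real (n - 1) * (real n + 1) \<le> real (n - 1) * (real (n\<^sup>2 + n + 1))"
    by (intro mult_left_mono) auto
  then have "real (n - 1) / 2 \<le> real (n ^ 3 - 1) / (2 * (real n + 1))"
    unfolding cube_minus_1 of_nat_mult by (simp add: field_simps)
  then have "ereal (real (n - 1) / 2) \<le> ereal (real (n ^ 3 - 1) / (2 * (real n + 1)))"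
    by (simp only: ereal_less_eq)
  also have "\<dots> = ereal (real (n ^ 3 - 1)) * inverse (ereal (2 * (real n + 1)))"
    by (simp only: nonzero inverse_ereal.simps if_False times_ereal.simps divide_inverse)
  \<comment> \<open>In \<open>ereal\<close>, \<open>inverse 0 = \<infinity>\<close>, so a relaxation
    of value 0 is covered too.\<close>
  also have "\<dots> \<le> ereal (real (n ^ 3 - 1)) * inverse ?sa"
    using sa_opt_nonneg sa_opt_le[OF assms] by (intro ereal_mult_left_mono ereal_inverse_antimono) auto
  also have "\<dots> \<le> lbfl_opt (gap_instance n) * inverse ?sa"
    using lbfl_opt_ge[OF assms] sa_opt_nonneg by (intro ereal_mult_right_mono inverse_ereal_ge0I)
  finally show ?thesis
    by (simp add: integrality_gap_def divide_ereal_def)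
qed

theorem theorem4:
  "\<exists>(I :: nat \<Rightarrow> (nat, nat) lbfl) (k :: nat \<Rightarrow> nat).
     (\<forall>n\<ge>2. lbfl_instance (I n) \<and>
            card (facilities (I n)) = n \<and>
            card (clients (I n)) = n ^ 4 - n \<and>
            lbfl_solutions (I n) \<noteq> {}) \<and>
     (\<lambda>n. real (k n)) \<in> \<Omega>(\<lambda>n. real n) \<and>
     (\<lambda>n. integrality_gap (k n) (I n)) \<longlonglongrightarrow> \<infinity>"
proof (intro exI conjI allI impI)
  show "lbfl_instance (gap_instance n)" for n
    by (rule lbfl_instance_gap_instance)
  show "lbfl_solutions (gap_instance n) \<noteq> {}" if "n \<ge> 2" for n
    using outcome_solution[OF that, of 0] that by auto
  show "(\<lambda>n. real ((n - 1) div 2)) \<in> \<Omega>(\<lambda>n. real n)"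
  \<comment> \<open>\<open>(n - 1) div 2 \<ge> n / 2 - 1\<close>, which is at least
    \<open>n / 4\<close> once \<open>n \<ge> 4\<close>.\<close>
  proof (rule landau_omega.bigI[of "1 / 4"])
    show "\<forall>\<^sub>F n in sequentially. norm (real ((n - 1) div 2)) \<ge> 1 / 4 * norm (real n)"
      using eventually_ge_at_top[of 4] by eventually_elim (simp; linarith)
  qed simp
  show "(\<lambda>n. integrality_gap ((n - 1) div 2) (gap_instance n)) \<longlonglongrightarrow> \<infinity>"
    unfolding tendsto_PInfty
  proof
    fix r :: real
    \<comment> \<open>The threshold solves \<open>r < (n - 1) / 2\<close>, the lower bound on the
      gap.\<close>
    have "\<forall>\<^sub>F n in sequentially. 2 * r + 1 < real n"
      using filterlim_real_sequentially by (simp add: filterlim_at_top_dense)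
    then show "\<forall>\<^sub>F n in sequentially. ereal r < integrality_gap ((n - 1) div 2) (gap_instance n)"
      using eventually_ge_at_top[of 2]
    proof eventually_elim
      case (elim n)
      then have "ereal r < ereal (real (n - 1) / 2)"
        by (simp add: of_nat_diff)
      also note integrality_gap_ge[OF elim(2)]
      finally show ?case .
    qed
  qed
qed simp_all

end
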